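(* Let $\mathbb{K}$ be $\mathbb{R}$ or $\mathbb{C}$, and let $X$ be an exponential vector space over $\mathbb{K}$ with additive identity $\theta$. Suppose there exists a non-void family $\mathscr{U}$ of subsets of $X$ satisfying the following conditions: (i) every $U\in\mathscr{U}$ is balanced and absorbing; (ii) for every $U\in\mathscr{U}$ there exists $V\in\mathscr{U}$ such that $V+V\subseteq U$; (iii) for all $U_1,U_2\in\mathscr{U}$ there exists $W\in\mathscr{U}$ such that $W\subseteq U_1\cap U_2$; (iv) for any $x,y\in X$ with $x\nleq y$ there exist $U,V\in\mathscr{U}$ such that $\uparrow(x+U)\,\cap\downarrow(y+V)=\emptyset$; (v) for any $W\in\mathscr{U}$, $x\in X$ and $\alpha\in\mathbb{K}$ there exist $\epsilon>0$ and $U\in\mathscr{U}$ such that $B(\alpha,\epsilon)\cdot(x+U)\subseteq\alpha x+W$, where $B(\alpha,\epsilon):=\{\lambda\in\mathbb{K}:|\alpha-\lambda|<\epsilon\}$ is the open disc in $\mathbb{K}$ with center $\alpha$ and radius $\epsilon$. Then there exists a unique topology on $X$, depending upon $\mathscr{U}$, with respect to which $X$ becomes a topological exponential vector space over $\mathbb{K}$. Moreover, $\mathscr{U}$ forms a local base at $\theta$ in that topology.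
   Context: An exponential vector space (evs) over a field $K$ is a partially ordered set $(X,\leq)$ with a binary operation $+$ on $X$ and a scalar multiplication $\cdot:K\times X\to X$ such that for all $x,y,z\in X$, $\alpha,\beta\in K$: ($A_1$) $(X,+)$ is a commutative semigroup with identity $\theta$; ($A_2$) $x\leq y$ implies $x+z\leq y+z$ and $\alpha\cdot x\leq\alpha\cdot y$; ($A_3$) $\alpha\cdot(x+y)=\alpha\cdot x+\alpha\cdot y$, $\alpha\cdot(\beta\cdot x)=(\alpha\beta)\cdot x$, $(\alpha+\beta)\cdot x\leq\alpha\cdot x+\beta\cdot x$, $1\cdot x=x$; ($A_4$) $\alpha\cdot x=\theta$ iff $\alpha=0$ or $x=\theta$; ($A_5$) $x+(-1)\cdot x=\theta$ iff $x\in X_0:=\{z\in X: y\nleq z\ \forall y\in X\smallsetminus\{z\}\}$ (the set of minimal elements); ($A_6$) for each $x\in X$ there is $p\in X_0$ with $p\leq x$. A topological evs over $\mathbb{K}$ ($=\mathbb{R}$ or $\mathbb{C}$, usual topology) is an evs $X$ over $\mathbb{K}$ with a topology such that addition $X\times X\to X$ and scalar multiplication $\mathbb{K}\times X\to X$ are continuous and the partial order is closed, i.e. $\{(x,y)\in X\times X:x\leq y\}$ is closed in $X\times X$. A set $A\subseteq X$ is absorbing if for every $x\in X$ there is a real $\alpha>0$ such that $\mu x\in A$ for all $\mu\in\mathbb{K}$ with $|\mu|\leq\alpha$. It is balanced if $\alpha A\subseteq A$ for all $\alpha\in\mathbb{K}$ with $|\alpha|\leq1$. For $A,B\subseteq X$,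 $S\subseteq\mathbb{K}$, $x\in X$, $\alpha\in\mathbb{K}$: $A+B=\{a+b:a\in A,b\in B\}$, $x+A=\{x+a:a\in A\}$, $\alpha A=\{\alpha a:a\in A\}$, $S\cdot A=\{\lambda a:\lambda\in S,a\in A\}$, $\uparrow A=\{x\in X:x\geq a\text{ for some }a\in A\}$, $\downarrow A=\{x\in X:x\leq a\text{ for some }a\in A\}$. Neighbourhoods of a point are sets containing an open set containing the point (not necessarily open); a local base at a point is a family of neighbourhoods of that point such that every neighbourhood of the point contains a member of the family. *)

theory Defs
  imports "HOL-Analysis.Analysis" "HOL-Library.Set_Algebras"
begin

definition minimal_elements :: "'a::order set"
  where "minimal_elements = {z. \<forall>y \<in> UNIV - {z}. \<not> y \<le> z}"

text \<open>
  The partial order, the commutative semigroup with identity and the compatibility of the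
  order with addition are those of class \<^class>\<open>ordered_comm_monoid_add\<close>; the identity
  \<open>\<theta>\<close> is \<open>0 :: 'a\<close>. The underlying set of the space is the whole type.
\<close>

locale exponential_vector_space =
  fixes smul :: "'k::field \<Rightarrow> 'a::ordered_comm_monoid_add \<Rightarrow> 'a"
  assumes smul_mono: "x \<le> y \<Longrightarrow> smul \<alpha> x \<le> smul \<alpha> y"
    and smul_add_right: "smul \<alpha> (x + y) = smul \<alpha> x + smul \<alpha> y"
    and smul_smul: "smul \<alpha> (smul \<beta> x) = smul (\<alpha> * \<beta>) x"
    and smul_add_left_le: "smul (\<alpha> + \<beta>) x \<le> smul \<alpha> x + smul \<beta> x"
    and smul_one: "smul 1 x = x"
    and smul_eq_0_iff: "smul \<alpha> x = 0 \<longleftrightarrow> \<alpha> = 0 \<or> x = 0"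
    and add_neg_eq_0_iff: "x + smul (- 1) x = 0 \<longleftrightarrow> x \<in> minimal_elements"
    and ex_minimal_le: "\<exists>p \<in> minimal_elements. p \<le> x"

text \<open>
  The scalars form a type of class \<^class>\<open>real_normed_field\<close>. Both \<^typ>\<open>real\<close> and
  \<^typ>\<open>complex\<close> are instances, and since the norm of that class is multiplicative, the
  Gelfand-Mazur theorem shows that there are no others up to isometric isomorphism.
\<close>

locale topological_exponential_vector_space =
  exponential_vector_space smul
  for smul :: "'k::real_normed_field \<Rightarrow> 'a::ordered_comm_monoid_add \<Rightarrow> 'a" +
  fixes T :: "'a topology"
  assumes topspace_eq: "topspace T = UNIV"
    and continuous_add: "continuous_map (prod_topology T T) T (\<lambda>(x, y). x + y)"
    and continuous_smul:
      "continuous_map (prod_topology euclidean T) T (\<lambda>(\<alpha>, x). smul \<alpha> x)"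
    and closed_order: "closedin (prod_topology T T) {(x, y). x \<le> y}"

definition absorbing :: "('k::real_normed_field \<Rightarrow> 'a \<Rightarrow> 'a) \<Rightarrow> 'a set \<Rightarrow> bool"
  where "absorbing smul A \<longleftrightarrow>
    (\<forall>x. \<exists>\<alpha>::real. \<alpha> > 0 \<and> (\<forall>\<mu>. norm \<mu> \<le> \<alpha> \<longrightarrow> smul \<mu> x \<in> A))"

definition balanced :: "('k::real_normed_field \<Rightarrow> 'a \<Rightarrow> 'a) \<Rightarrow> 'a set \<Rightarrow> bool"
  where "balanced smul A \<longleftrightarrow> (\<forall>\<alpha>. norm \<alpha> \<le> 1 \<longrightarrow> smul \<alpha> ` A \<subseteq> A)"

definition smul_set :: "('k \<Rightarrow> 'a \<Rightarrow> 'a) \<Rightarrow> 'k set \<Rightarrow> 'a set \<Rightarrow> 'a set"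
  where "smul_set smul S A = {smul s a | s a. s \<in> S \<and> a \<in> A}"

definition up_set :: "'a::order set \<Rightarrow> 'a set"
  where "up_set A = {x. \<exists>a \<in> A. x \<ge> a}"

definition down_set :: "'a::order set \<Rightarrow> 'a set"
  where "down_set A = {x. \<exists>a \<in> A. x \<le> a}"

text \<open>Neighbourhoods, and hence the members of a local base, need not be open.\<close>

definition neighbourhood_of :: "'a topology \<Rightarrow> 'a \<Rightarrow> 'a set \<Rightarrow> bool"
  where "neighbourhood_of T x N \<longleftrightarrow>
    N \<subseteq> topspace T \<and> (\<exists>G. openin T G \<and> x \<in> G \<and> G \<subseteq> N)"

definition local_base_at :: "'a topology \<Rightarrow> 'a \<Rightarrow> 'a set set \<Rightarrow> bool"
  where "local_base_at T x \<B> \<longleftrightarrow>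
    (\<forall>B \<in> \<B>. neighbourhood_of T x B) \<and>
    (\<forall>N. neighbourhood_of T x N \<longrightarrow> (\<exists>B \<in> \<B>. B \<subseteq> N))"

end

theory Submission
  imports Defs
begin

text \<open>
  The topology is the one whose open sets are the sets \<open>G\<close> such that every \<open>x \<in> G\<close> has
  \<open>x + U \<subseteq> G\<close> for some \<open>U \<in> \<U>\<close>. By (ii) each \<open>x + U\<close> is then a neighbourhood of \<open>x\<close>, and (ii),
  (v) and (iv) say directly that addition and scalar multiplication are continuous and that the
  order is closed.

  Uniqueness is the delicate part: in a topological exponential vector space translations need not
  be homeomorphisms, so open sets cannot in general be moved to \<open>\<theta>\<close> and compared there. Here they
  can, because (v) is so strong that it makes every element invertible. At \<open>\<alpha> = 1\<close> it gives a real
  \<open>0 < c < 1\<close> and \<open>w\<close> with \<open>c x = x + w\<close>. Heuristically \<open>x = - w / (1 - c)\<close>, and indeed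
  \<open>z = x + w / (1 - c)\<close> satisfies \<open>z \<le> c z\<close>, hence \<open>z \<le> c\<^sup>n z\<close> for all \<open>n\<close>. As \<open>c\<^sup>n z\<close> tends to
  \<open>\<theta>\<close> and the order is closed, \<open>z \<le> \<theta>\<close>, so \<open>z = \<theta>\<close> by minimality of \<open>\<theta>\<close>. From this
  \<open>x + (-1)x = \<theta>\<close> for all \<open>x\<close>, so every translation has a translation as inverse.
\<close>

section \<open>Algebraic preliminaries\<close>

context exponential_vector_space
begin

lemma smul_0_left: "smul 0 x = 0"
  by (simp add: smul_eq_0_iff)

lemma smul_0_right: "smul \<alpha> 0 = 0"
  by (simp add: smul_eq_0_iff)

lemma le_0_imp_eq_0:
  fixes x :: 'a
  assumes "x \<le> 0"
  shows "x = 0"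
proof -
  have "(0::'a) \<in> minimal_elements"
    using add_neg_eq_0_iff[of 0] by (simp add: smul_0_right)
  then show ?thesis
    using assms by (auto simp: minimal_elements_def)
qed

text \<open>
  Subdistributivity gives \<open>0 = (1 - 1)x \<le> x + (-1)x\<close>; adding an inverse \<open>s\<close> of the right-hand side
  yields \<open>s \<le> 0\<close>, so \<open>s\<close> and with it the right-hand side vanish.
\<close>

lemma add_neg_eq_0_if_invertible:
  assumes inv: "\<And>x::'a. \<exists>q. x + q = 0"
  shows "x + smul (- 1) x = 0"
proof -
  let ?t = "x + smul (- 1) x"
  obtain s where s: "?t + s = 0"
    using inv by blast
  have "0 \<le> ?t"
    using smul_add_left_le[of 1 "- 1" x] by (simp add: smul_0_left smul_one)
  then have "0 + s \<le> ?t + s"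
    by (rule add_right_mono)
  then have "s = 0"
    using s le_0_imp_eq_0 by simp
  then show ?thesis
    using s by simp
qed

end

lemma (in topological_exponential_vector_space) continuous_translation:
  "continuous_map T T (\<lambda>y. a + y)"
proof -
  have "continuous_map T (prod_topology T T) (\<lambda>y. (a, y))"
    by (simp add: continuous_map_pairwise o_def topspace_eq)
  from continuous_map_compose[OF this continuous_add] show ?thesis
    by (simp add: o_def)
qed

section \<open>The topology generated by a base at the identity\<close>

locale evs_with_base = exponential_vector_space smul
  for smul :: "'k::real_normed_field \<Rightarrow> 'a::ordered_comm_monoid_add \<Rightarrow> 'a" +
  fixes \<U> :: "'a set set"
  assumes nonvoid: "\<U> \<noteq> {}"
    and base_absorbing: "U \<in> \<U> \<Longrightarrow> absorbing smul U"
    and base_halving: "U \<in> \<U> \<Longrightarrow> \<exists>V \<in> \<U>. V + V \<subseteq> U"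
    and base_Int: "U \<in> \<U> \<Longrightarrow> V \<in> \<U> \<Longrightarrow> \<exists>W \<in> \<U>. W \<subseteq> U \<inter> V"
    and base_separates: "\<not> x \<le> y \<Longrightarrow>
      \<exists>U \<in> \<U>. \<exists>V \<in> \<U>. up_set (x +o U) \<inter> down_set (y +o V) = {}"
    and base_smul: "W \<in> \<U> \<Longrightarrow>
      \<exists>\<epsilon>>0. \<exists>U \<in> \<U>. smul_set smul (ball \<alpha> \<epsilon>) (x +o U) \<subseteq> smul \<alpha> x +o W"
begin

lemma zero_mem_base:
  assumes "U \<in> \<U>"
  shows "0 \<in> U"
proof -
  obtain \<alpha> :: real where "\<alpha> > 0" "\<forall>\<mu>. norm \<mu> \<le> \<alpha> \<longrightarrow> smul \<mu> 0 \<in> U"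
    using base_absorbing[OF assms] unfolding absorbing_def by blast
  then have "smul 0 0 \<in> U"
    by simp
  then show ?thesis
    by (simp add: smul_0_left)
qed

lemma mem_translate_base: "U \<in> \<U> \<Longrightarrow> x \<in> x +o U"
  using zero_mem_base set_plus_intro2[of 0 U x] by simp

definition base_open :: "'a set \<Rightarrow> bool"
  where "base_open G \<longleftrightarrow> (\<forall>x\<in>G. \<exists>U\<in>\<U>. x +o U \<subseteq> G)"

definition base_topology :: "'a topology"
  where "base_topology = topology base_open"

lemma istopology_base_open: "istopology base_open"
  unfolding istopology_def
proof (intro conjI allI impI)
  fix S R assume S: "base_open S" and R: "base_open R"
  show "base_open (S \<inter> R)"
    unfolding base_open_def
  proof
    fix x assume "x \<in> S \<inter> R"
    then obtain U V where UV: "U \<in> \<U>" "x +o U \<subseteq> S" "V \<in> \<U>" "x +o V \<subseteq> R"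
      using S R unfolding base_open_def by blast
    obtain W where W: "W \<in> \<U>" "W \<subseteq> U \<inter> V"
      using base_Int UV(1,3) by blast
    have "x +o W \<subseteq> x +o U" "x +o W \<subseteq> x +o V"
      using W(2) by (auto intro!: set_plus_mono)
    then show "\<exists>U\<in>\<U>. x +o U \<subseteq> S \<inter> R"
      using UV(2,4) W(1) by (meson le_inf_iff order_trans)
  qed
next
  fix \<K> assume "\<forall>K\<in>\<K>. base_open K"
  then show "base_open (\<Union>\<K>)"
    unfolding base_open_def by (meson Union_iff Union_upper order_trans)
qed

lemma openin_base_topology:
  "openin base_topology G \<longleftrightarrow> (\<forall>x\<in>G. \<exists>U\<in>\<U>. x +o U \<subseteq> G)"
  using istopology_base_open
  by (simp add: base_topology_def topology_inverse' base_open_def)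

lemma topspace_base_topology: "topspace base_topology = UNIV"
proof -
  have "openin base_topology UNIV"
    using nonvoid by (auto simp: openin_base_topology)
  then show ?thesis
    using openin_subset by blast
qed

text \<open>
  The points \<open>y\<close> for which \<open>x + U\<close> contains some \<open>y + V\<close> form an open set, since \<open>V\<close> can be
  replaced by a half of it.
\<close>

lemma openin_within_translate:
  assumes "U \<in> \<U>"
  obtains G where "openin base_topology G" "x \<in> G" "G \<subseteq> x +o U"
proof
  let ?G = "{y. \<exists>V\<in>\<U>. y +o V \<subseteq> x +o U}"
  show "openin base_topology ?G"
    unfolding openin_base_topology
  proof
    fix y assume "y \<in> ?G"
    then obtain V where V: "V \<in> \<U>" "y +o V \<subseteq> x +o U"
      by blast
    obtain V' where V': "V' \<in> \<U>" "V' + V' \<subseteq> V"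
      using base_halving V(1) by blast
    have "z +o V' \<subseteq> x +o U" if z: "z \<in> y +o V'" for z
    proof
      fix u assume "u \<in> z +o V'"
      then obtain b where b: "b \<in> V'" "u = z + b"
        unfolding elt_set_plus_def by blast
      obtain a where a: "a \<in> V'" "z = y + a"
        using z unfolding elt_set_plus_def by blast
      have "a + b \<in> V"
        using a(1) b(1) V'(2) set_plus_intro by blast
      then show "u \<in> x +o U"
        using V(2) a(2) b(2) unfolding elt_set_plus_def by (auto simp: add.assoc)
    qed
    then show "\<exists>V\<in>\<U>. y +o V \<subseteq> ?G"
      using V'(1) by blast
  qed
  show "x \<in> ?G"
    using assms by blast
  show "?G \<subseteq> x +o U"
    using mem_translate_base by blast
qed

lemma continuous_map_add_base_topology:
  "continuous_map (prod_topology base_topology base_topology) base_topology (\<lambda>(x, y). x + y)"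
  unfolding continuous_map_eq_topcontinuous_at topcontinuous_at_def
proof (intro ballI conjI allI impI)
  fix p G
  assume G: "openin base_topology G \<and> (case p of (x, y) \<Rightarrow> x + y) \<in> G"
  obtain x y where p: "p = (x, y)"
    by (cases p)
  obtain U where U: "U \<in> \<U>" "(x + y) +o U \<subseteq> G"
    using G p unfolding openin_base_topology by auto
  obtain V where V: "V \<in> \<U>" "V + V \<subseteq> U"
    using base_halving U(1) by blast
  obtain A where A: "openin base_topology A" "x \<in> A" "A \<subseteq> x +o V"
    using openin_within_translate V(1) by blast
  obtain B where B: "openin base_topology B" "y \<in> B" "B \<subseteq> y +o V"
    using openin_within_translate V(1) by blast
  have "a + b \<in> G" if ab: "a \<in> A" "b \<in> B" for a b
  proof -
    obtain v w where vw: "v \<in> V" "a = x + v" "w \<in> V" "b = y + w"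
      using ab A(3) B(3) unfolding elt_set_plus_def by blast
    have "v + w \<in> U"
      using vw V(2) set_plus_intro by blast
    then have "(x + y) + (v + w) \<in> G"
      using U(2) set_plus_intro2 by blast
    then show ?thesis
      using vw by (simp add: ac_simps)
  qed
  then have "\<forall>q\<in>A \<times> B. (case q of (x, y) \<Rightarrow> x + y) \<in> G"
    by auto
  moreover have "openin (prod_topology base_topology base_topology) (A \<times> B)"
    using A B by (simp add: openin_prod_Times_iff)
  moreover have "p \<in> A \<times> B"
    using A B p by simp
  ultimately show "\<exists>W. openin (prod_topology base_topology base_topology) W \<and> p \<in> W \<and>
      (\<forall>q\<in>W. (case q of (x, y) \<Rightarrow> x + y) \<in> G)"
    by blast
qed (auto simp: topspace_base_topology)

lemma continuous_map_smul_base_topology: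
  "continuous_map (prod_topology euclidean base_topology) base_topology (\<lambda>(\<alpha>, x). smul \<alpha> x)"
  unfolding continuous_map_eq_topcontinuous_at topcontinuous_at_def
proof (intro ballI conjI allI impI)
  fix p :: "'k \<times> 'a" and G
  assume G: "openin base_topology G \<and> (case p of (\<alpha>, x) \<Rightarrow> smul \<alpha> x) \<in> G"
  obtain \<alpha> x where p: "p = (\<alpha>, x)"
    by (cases p)
  obtain W where W: "W \<in> \<U>" "smul \<alpha> x +o W \<subseteq> G"
    using G p unfolding openin_base_topology by auto
  obtain \<epsilon> U where \<epsilon>: "\<epsilon> > 0" and U: "U \<in> \<U>"
    and sub: "smul_set smul (ball \<alpha> \<epsilon>) (x +o U) \<subseteq> smul \<alpha> x +o W"
    using base_smul W(1) by blast
  obtain B where B: "openin base_topology B" "x \<in> B" "B \<subseteq> x +o U"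
    using openin_within_translate U by blast
  have "smul \<beta> b \<in> G" if "\<beta> \<in> ball \<alpha> \<epsilon>" "b \<in> B" for \<beta> b
  proof -
    have "smul \<beta> b \<in> smul_set smul (ball \<alpha> \<epsilon>) (x +o U)"
      unfolding smul_set_def using that B(3) by blast
    then show ?thesis
      using sub W(2) by blast
  qed
  then have "\<forall>q\<in>ball \<alpha> \<epsilon> \<times> B. (case q of (\<alpha>, x) \<Rightarrow> smul \<alpha> x) \<in> G"
    by auto
  moreover have "openin (prod_topology euclidean base_topology) (ball \<alpha> \<epsilon> \<times> B)"
    using B by (simp add: openin_prod_Times_iff)
  moreover have "p \<in> ball \<alpha> \<epsilon> \<times> B"
    using B \<epsilon> p by simp
  ultimately show "\<exists>W. openin (prod_topology euclidean base_topology) W \<and> p \<in> W \<and>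
      (\<forall>q\<in>W. (case q of (\<alpha>, x) \<Rightarrow> smul \<alpha> x) \<in> G)"
    by blast
qed (auto simp: topspace_base_topology)

lemma closedin_order_base_topology:
  "closedin (prod_topology base_topology base_topology) {(x, y). x \<le> y}"
proof -
  have "\<exists>W. openin (prod_topology base_topology base_topology) W \<and> p \<in> W \<and>
      W \<subseteq> - {(x, y). x \<le> y}" if p_notin: "p \<in> - {(x, y). x \<le> y}" for p
  proof -
    obtain x y where p: "p = (x, y)" "\<not> x \<le> y"
      using p_notin by (cases p) auto
    obtain U V where UV: "U \<in> \<U>" "V \<in> \<U>"
      and disj: "up_set (x +o U) \<inter> down_set (y +o V) = {}"
      using base_separates p(2) by blast
    obtain A where A: "openin base_topology A" "x \<in> A" "A \<subseteq> x +o U"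
      using openin_within_translate UV(1) by blast
    obtain B where B: "openin base_topology B" "y \<in> B" "B \<subseteq> y +o V"
      using openin_within_translate UV(2) by blast
    have "\<not> a \<le> b" if "a \<in> A" "b \<in> B" for a b
    proof
      assume "a \<le> b"
      then have "b \<in> up_set (x +o U) \<inter> down_set (y +o V)"
        using that A(3) B(3) unfolding up_set_def down_set_def by blast
      then show False
        using disj by blast
    qed
    moreover have "openin (prod_topology base_topology base_topology) (A \<times> B)"
      using A B by (simp add: openin_prod_Times_iff)
    moreover have "p \<in> A \<times> B"
      using A B p by simp
    ultimately show ?thesis
      by blast
  qed
  then have "openin (prod_topology base_topology base_topology) (- {(x, y). x \<le> y})"
    by (subst openin_subopen) blast
  then show ?thesis
    by (simp add: closedin_def topspace_base_topology Compl_eq_Diff_UNIV)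
qed

lemma topological_evs_base_topology:
  "topological_exponential_vector_space smul base_topology"
  by unfold_locales
    (fact topspace_base_topology continuous_map_add_base_topology
      continuous_map_smul_base_topology closedin_order_base_topology)+

lemma local_base_at_base_topology: "local_base_at base_topology 0 \<U>"
  unfolding local_base_at_def
proof (intro conjI ballI allI impI)
  fix U assume "U \<in> \<U>"
  then obtain G where "openin base_topology G" "0 \<in> G" "G \<subseteq> 0 +o U"
    using openin_within_translate by blast
  then show "neighbourhood_of base_topology 0 U"
    unfolding neighbourhood_of_def by (auto simp: topspace_base_topology)
next
  fix N assume "neighbourhood_of base_topology 0 N"
  then obtain G where G: "openin base_topology G" "0 \<in> G" "G \<subseteq> N"
    unfolding neighbourhood_of_def by blast
  then obtain U where "U \<in> \<U>" "0 +o U \<subseteq> G"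
    unfolding openin_base_topology by blast
  then show "\<exists>U\<in>\<U>. U \<subseteq> N"
    using G by auto
qed

section \<open>Invertibility of all elements and uniqueness of the topology\<close>

text \<open>
  Since the members of \<open>\<U>\<close> absorb \<open>z\<close>, the multiples \<open>c\<^sup>n z\<close>, all of which dominate \<open>z\<close>, come arbitrarily close
  to \<open>0\<close>; separation by \<open>\<U>\<close> passes the inequality to the limit.
\<close>

lemma le_smul_imp_eq_0:
  assumes norm: "norm c < 1" and le: "z \<le> smul c z"
  shows "z = 0"
proof (rule le_0_imp_eq_0, rule ccontr)
  assume "\<not> z \<le> 0"
  then obtain U V where UV: "U \<in> \<U>" "V \<in> \<U>"
    and disj: "up_set (z +o U) \<inter> down_set (0 +o V) = {}"
    using base_separates by blast
  obtain \<alpha> :: real where \<alpha>: "\<alpha> > 0" "\<forall>\<mu>. norm \<mu> \<le> \<alpha> \<longrightarrow> smul \<mu> z \<in> V"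
    using base_absorbing[OF UV(2)] unfolding absorbing_def by blast
  obtain n where "norm c ^ n < \<alpha>"
    using real_arch_pow_inv[OF \<alpha>(1) norm] by blast
  then have "smul (c ^ n) z \<in> V"
    using \<alpha>(2) by (simp add: norm_power)
  moreover have "z \<le> smul (c ^ n) z"
  proof (induction n)
    case 0
    show ?case by (simp add: smul_one)
  next
    case (Suc n)
    from le smul_mono[OF Suc, of c] have "z \<le> smul c (smul (c ^ n) z)"
      by (rule order_trans)
    then show ?case by (simp add: smul_smul)
  qed
  ultimately have "z \<in> down_set (0 +o V)"
    unfolding down_set_def by auto
  moreover have "z \<in> up_set (z +o U)"
    using mem_translate_base UV(1) unfolding up_set_def by blast
  ultimately show False
    using disj by blast
qed

text \<open>
  Continuity of \<open>c \<mapsto> c x\<close> at \<open>1\<close>, with the neighbourhoods \<open>x + W\<close>, forces \<open>c x\<close> to be a translate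
  of \<open>x\<close> even when \<open>0 < c < 1\<close>, say \<open>c x = x + w\<close>. Here \<open>w\<close> acts as \<open>(c - 1) x\<close>, so \<open>w / (1 - c)\<close> is the
  candidate for the inverse of \<open>x\<close>.
\<close>

lemma ex_add_eq_0: "\<exists>q. (x::'a) + q = 0"
proof -
  obtain W where W: "W \<in> \<U>"
    using nonvoid by blast
  obtain \<epsilon> U where \<epsilon>: "\<epsilon> > 0" and U: "U \<in> \<U>"
    and sub: "smul_set smul (ball 1 \<epsilon>) (x +o U) \<subseteq> smul 1 x +o W"
    using base_smul[OF W, of 1 x] by blast
  define \<delta> where "\<delta> = min (1/2) (\<epsilon>/2)"
  have \<delta>: "0 < \<delta>" "\<delta> < 1" "\<delta> < \<epsilon>"
    using \<epsilon> by (auto simp: \<delta>_def)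
  define c :: 'k where "c = of_real (1 - \<delta>)"
  have norm_c: "norm c < 1"
    unfolding c_def norm_of_real using \<delta> by simp
  have one_minus: "1 - c = of_real \<delta>"
    by (simp add: c_def)
  have "c \<in> ball 1 \<epsilon>"
    unfolding mem_ball dist_norm one_minus norm_of_real using \<delta> by simp
  then have "smul c x \<in> smul 1 x +o W"
    using sub mem_translate_base[OF U, of x] unfolding smul_set_def by blast
  then obtain w where w: "smul c x = x + w"
    unfolding elt_set_plus_def by (auto simp: smul_one)
  define q where "q = smul (inverse (1 - c)) w"
  have "1 - c \<noteq> 0"
    using \<delta> by (simp add: one_minus)
  then have "smul (1 - c) q = w"
    by (simp add: q_def smul_smul smul_one)
  \<comment> \<open>Subdistributivity for \<open>1 = (1 - c) + c\<close>\<close>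
  then have "q \<le> w + smul c q"
    using smul_add_left_le[of "1 - c" c q] by (simp add: smul_one)
  then have "x + q \<le> x + (w + smul c q)"
    by (rule add_left_mono)
  also have "\<dots> = smul c (x + q)"
    by (simp add: smul_add_right w add.assoc)
  finally have "x + q = 0"
    by (rule le_smul_imp_eq_0[OF norm_c])
  then show ?thesis ..
qed

lemma add_neg_eq_0: "x + smul (- 1) x = 0"
  using add_neg_eq_0_if_invertible ex_add_eq_0 by blast

text \<open>
  Translation by \<open>x\<close> carries neighbourhoods of \<open>0\<close> to neighbourhoods of \<open>x\<close> because translation by
  \<open>(-1)x\<close>, its inverse, is continuous; hence the base at \<open>0\<close> determines all open sets.
\<close>

lemma base_topology_unique:
  assumes tevs: "topological_exponential_vector_space smul T"
    and base: "local_base_at T 0 \<U>"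
  shows "T = base_topology"
proof -
  interpret T: topological_exponential_vector_space smul T
    by (fact tevs)
  have preimage_open: "openin T {y. a + y \<in> G}" if "openin T G" for a G
    using openin_continuous_map_preimage[OF T.continuous_translation[of a] that]
    by (simp add: T.topspace_eq)
  have "openin T G \<longleftrightarrow> openin base_topology G" for G
  proof
    assume G: "openin T G"
    show "openin base_topology G"
      unfolding openin_base_topology
    proof
      fix x assume "x \<in> G"
      then have "neighbourhood_of T 0 {y. x + y \<in> G}"
        using preimage_open[OF G, of x] unfolding neighbourhood_of_def
        by (auto simp: T.topspace_eq)
      then obtain U where U: "U \<in> \<U>" "U \<subseteq> {y. x + y \<in> G}"
        using base unfolding local_base_at_def by blast
      then have "x +o U \<subseteq> G"
        by (auto simp: elt_set_plus_def)
      then show "\<exists>U\<in>\<U>. x +o U \<subseteq> G"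
        using U(1) by blast
    qed
  next
    assume G: "openin base_topology G"
    have "\<exists>B. openin T B \<and> x \<in> B \<and> B \<subseteq> G" if x: "x \<in> G" for x
    proof -
      obtain U where U: "U \<in> \<U>" "x +o U \<subseteq> G"
        using G x unfolding openin_base_topology by blast
      have "neighbourhood_of T 0 U"
        using base U(1) unfolding local_base_at_def by simp
      then obtain H where H: "openin T H" "0 \<in> H" "H \<subseteq> U"
        unfolding neighbourhood_of_def by auto
      let ?B = "{y. smul (- 1) x + y \<in> H}"
      have "y \<in> G" if "y \<in> ?B" for y
      proof -
        have "x + (smul (- 1) x + y) \<in> x +o U"
          using that H(3) by (auto intro: set_plus_intro2)
        moreover have "x + (smul (- 1) x + y) = y"
          by (simp add: add.assoc[symmetric] add_neg_eq_0)
        ultimately show ?thesis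
          using U(2) by auto
      qed
      moreover have "x \<in> ?B"
        using H(2) add_neg_eq_0[of x] by (simp add: add.commute)
      ultimately show ?thesis
        using preimage_open[OF H(1)] by blast
    qed
    then show "openin T G"
      by (subst openin_subopen) blast
  qed
  then show ?thesis
    by (simp add: topology_eq)
qed

end

theorem theorem4p7:
  fixes smul :: "'k::real_normed_field \<Rightarrow> 'a::ordered_comm_monoid_add \<Rightarrow> 'a"
    and \<U> :: "'a set set"
  assumes evs: "exponential_vector_space smul"
    and nonvoid: "\<U> \<noteq> {}"
    and i: "\<And>U. U \<in> \<U> \<Longrightarrow> balanced smul U \<and> absorbing smul U"
    and ii: "\<And>U. U \<in> \<U> \<Longrightarrow> \<exists>V \<in> \<U>. V + V \<subseteq> U"
    and iii: "\<And>U\<^sub>1 U\<^sub>2. U\<^sub>1 \<in> \<U> \<Longrightarrow> U\<^sub>2 \<in> \<U> \<Longrightarrow> \<exists>W \<in> \<U>. W \<subseteq> U\<^sub>1 \<inter> U\<^sub>2"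
    and iv: "\<And>x y. \<not> x \<le> y \<Longrightarrow>
      \<exists>U \<in> \<U>. \<exists>V \<in> \<U>. up_set (x +o U) \<inter> down_set (y +o V) = {}"
    and v: "\<And>W x \<alpha>. W \<in> \<U> \<Longrightarrow>
      \<exists>\<epsilon>>0. \<exists>U \<in> \<U>. smul_set smul (ball \<alpha> \<epsilon>) (x +o U) \<subseteq> smul \<alpha> x +o W"
  shows "\<exists>!T. topological_exponential_vector_space smul T \<and> local_base_at T 0 \<U>"
proof -
  interpret exponential_vector_space smul
    by (fact evs)
  interpret evs_with_base smul \<U>
    by unfold_locales (use nonvoid i ii iii iv v in \<open>simp_all\<close>)
  show ?thesis
    using topological_evs_base_topology local_base_at_base_topology base_topology_unique
    by blast
qed

end
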